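(* Let $\nu$ be a non-degenerate compactly supported probability measure on $\mathbb{R}$, and let $A=\min\{0,\inf\operatorname{supp}(\nu)\}$ and $B=\max\{0,\sup\operatorname{supp}(\nu)\}$. Then the domain of means of the two-sided Cauchy-Stieltjes kernel family generated by $\nu$ is the open interval $(m_-,m_+)$ with $$m_-=A-\frac{1}{G_\nu(A)},\qquad m_+=B-\frac{1}{G_\nu(B)},$$ where $1/G_\nu(A):=\lim_{z\nearrow A}1/G_\nu(z)$ and $1/G_\nu(B):=\lim_{z\searrow B}1/G_\nu(z)$ (these limits can be zero).
   Context: Non-degenerate means: not a point mass. $G_\nu(z)=\int\frac{1}{z-x}\nu(dx)$ is the Cauchy transform, considered for real $z\notin[A,B]$. Two-sided Cauchy-Stieltjes kernel family: let $\theta_+=1/B$ (with $\theta_+=+\infty$ if $B=0$) and $\theta_-=1/A$ (with $\theta_-=-\infty$ if $A=0$). For $\theta_-<\theta<\theta_+$ let $M(\theta)=\int\frac{1}{1-\theta x}\nu(dx)$ and $P_\theta(dx)=\frac{1}{M(\theta)(1-\theta x)}\nu(dx)$ (so $P_0=\nu$). The two-sided family is $\mathcal{K}(\nu)=\{P_\theta:\theta_-<\theta<\theta_+\}$, and its domain of means is the set $\{\int x\,P_\theta(dx):\theta_-<\theta<\theta_+\}$. *)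

theory Defs
  imports "HOL-Probability.Probability"
begin

definition measure_support :: "'a::topological_space measure \<Rightarrow> 'a set" where
  "measure_support \<nu> = {x. \<forall>U. open U \<and> x \<in> U \<longrightarrow> emeasure \<nu> U > 0}"

definition nondegenerate :: "real measure \<Rightarrow> bool" where
  "nondegenerate \<nu> \<longleftrightarrow> (\<nexists>a. \<nu> = return borel a)"

definition endpoint_A :: "real measure \<Rightarrow> real" where
  "endpoint_A \<nu> = min 0 (Inf (measure_support \<nu>))"

definition endpoint_B :: "real measure \<Rightarrow> real" where
  "endpoint_B \<nu> = max 0 (Sup (measure_support \<nu>))"

definition cauchy_transform :: "real measure \<Rightarrow> real \<Rightarrow> real" where
  "cauchy_transform \<nu> z = (\<integral>x. 1 / (z - x) \<partial>\<nu>)"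

definition theta_plus :: "real measure \<Rightarrow> ereal" where
  "theta_plus \<nu> = (if endpoint_B \<nu> = 0 then \<infinity> else ereal (1 / endpoint_B \<nu>))"

definition theta_minus :: "real measure \<Rightarrow> ereal" where
  "theta_minus \<nu> = (if endpoint_A \<nu> = 0 then -\<infinity> else ereal (1 / endpoint_A \<nu>))"

definition cs_norm :: "real measure \<Rightarrow> real \<Rightarrow> real" where
  "cs_norm \<nu> \<theta> = (\<integral>x. 1 / (1 - \<theta> * x) \<partial>\<nu>)"

(* For theta_minus < \<theta> < theta_plus the density is positive on the support, so the truncation
   of negative values by ennreal affects only a null set. *)
definition cs_measure :: "real measure \<Rightarrow> real \<Rightarrow> real measure" where
  "cs_measure \<nu> \<theta> = density \<nu> (\<lambda>x. ennreal (1 / (cs_norm \<nu> \<theta> * (1 - \<theta> * x))))"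

definition cs_family :: "real measure \<Rightarrow> real measure set" where
  "cs_family \<nu> = {cs_measure \<nu> \<theta> | \<theta>. theta_minus \<nu> < ereal \<theta> \<and> ereal \<theta> < theta_plus \<nu>}"

definition domain_of_means :: "real measure \<Rightarrow> real set" where
  "domain_of_means \<nu> = {\<integral>x. x \<partial>P | P. P \<in> cs_family \<nu>}"

(* The reciprocals 1 / G(A) and 1 / G(B) are these one-sided limits by definition; the
   Cauchy transform itself may diverge at A or B, in which case the reciprocal is 0. *)
definition inv_cauchy_A :: "real measure \<Rightarrow> real" where
  "inv_cauchy_A \<nu> = Lim (at_left (endpoint_A \<nu>)) (\<lambda>z. 1 / cauchy_transform \<nu> z)"

definition inv_cauchy_B :: "real measure \<Rightarrow> real" where
  "inv_cauchy_B \<nu> = Lim (at_right (endpoint_B \<nu>)) (\<lambda>z. 1 / cauchy_transform \<nu> z)"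

definition m_minus :: "real measure \<Rightarrow> real" where
  "m_minus \<nu> = endpoint_A \<nu> - inv_cauchy_A \<nu>"

definition m_plus :: "real measure \<Rightarrow> real" where
  "m_plus \<nu> = endpoint_B \<nu> - inv_cauchy_B \<nu>"

end

(* The mean m(\<theta>) of P_\<theta> is continuous in \<theta>, and strictly increasing: for \<theta> < \<eta> and c = m(\<theta>),
   the numerator of m(\<eta>) - c is a positive multiple of the integral of
   (x - c)^2 / ((1 - \<theta> x) (1 - \<eta> x)), which vanishes only for a point mass. Hence the means fill
   the open interval (inf m, sup m). For \<theta> = 1/z the mean is z - 1/G(z), so by monotonicity
   z - 1/G(z) tends to sup m as z decreases to B, and to inf m as z increases to A. *)
theory Submission
  imports Defs
begin

section \<open>Support of a measure and point masses\<close>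

text \<open>The complement of the support is the union of all open null sets. This union may be
  uncountable, but by Lindelof a countable subfamily has the same union, so it is null.\<close>

lemma AE_measure_support:
  fixes N :: "'a::second_countable_topology measure"
  assumes "sets N = sets borel"
  shows "AE x in N. x \<in> measure_support N"
proof -
  define F where "F = {U. open U \<and> emeasure N U = 0}"
  obtain F' where F': "F' \<subseteq> F" "countable F'" "\<Union>F' = \<Union>F"
    using Lindelof[of F] by (auto simp: F_def)
  have "(\<Union>U\<in>F'. U) \<in> null_sets N"
    using F' assms by (intro null_sets_UN') (auto simp: F_def null_sets_def)
  then have "AE x in N. x \<notin> \<Union>F"
    using F' by (intro AE_I'[of "\<Union>F"]) auto
  then show ?thesis
    by eventually_elim (auto simp: measure_support_def F_def zero_less_iff_neq_zero)
qed

text \<open>Compactness makes the support bounded, so that \<open>Inf\<close> and \<open>Sup\<close>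
  are genuine bounds for its points.\<close>

lemma AE_compact_support_bounds:
  fixes N :: "real measure"
  assumes "prob_space N" "sets N = sets borel" "compact (measure_support N)"
  shows "AE x in N. endpoint_A N \<le> x \<and> x \<le> endpoint_B N"
  using AE_measure_support[OF assms(2)]
proof eventually_elim
  case (elim x)
  have "bdd_below (measure_support N)" "bdd_above (measure_support N)"
    using compact_imp_bounded[OF assms(3)] by (auto simp: bounded_imp_bdd_below bounded_imp_bdd_above)
  then have "Inf (measure_support N) \<le> x" "x \<le> Sup (measure_support N)"
    using elim by (auto intro: cInf_lower cSup_upper)
  then show ?case by (auto simp: endpoint_A_def endpoint_B_def)
qed

text \<open>The equality case of the monotonicity argument yields only that \<open>x\<close> is
  constant almost everywhere; this turns it into a contradiction with
  \<open>nondegenerate\<close>.\<close>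

lemma eq_return_if_AE_eq_const:
  fixes M :: "'a::t1_space measure"
  assumes "prob_space M" "sets M = sets borel" "AE x in M. x = c"
  shows "M = return borel c"
proof (rule measure_eqI)
  interpret prob_space M by fact
  fix X assume X: "X \<in> sets M"
  show "emeasure M X = emeasure (return borel c) X"
  proof (cases "c \<in> X")
    case True
    have "AE x in M. x \<in> X" using assms(3) by eventually_elim (use True in simp)
    then have "emeasure M X = 1" using X by (simp add: emeasure_eq_1_AE)
    then show ?thesis using X True assms(2) by simp
  next
    case False
    have "AE x in M. x \<notin> X" using assms(3) by eventually_elim (use False in simp)
    then have "emeasure M X = 0" using X by (simp add: AE_iff_measurable[OF _ refl] AE_iff_null_sets null_setsD1)
    then show ?thesis using X False assms(2) by simp
  qed
qed (simp add: assms)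

section \<open>Kernel integrals over an interval\<close>

text \<open>The support enters the analysis only through almost sure bounds \<open>A\<close> and
  \<open>B\<close> with 0 between them.\<close>

locale interval_prob_space = prob_space N for N :: "real measure" +
  fixes A B :: real
  assumes sets_N [measurable_cong]: "sets N = sets borel"
    and AE_bounds: "AE x in N. A \<le> x \<and> x \<le> B"
    and A_nonpos: "A \<le> 0" and B_nonneg: "0 \<le> B"
begin

text \<open>This encodes \<open>\<theta>\<^sub>- < \<theta> < \<theta>\<^sub>+\<close> without the case distinction for \<open>A = 0\<close> or \<open>B = 0\<close>.\<close>

definition params :: "real set" where
  "params = {\<theta>. \<theta> * A < 1 \<and> \<theta> * B < 1}"

text \<open>The mean of \<open>cs_measure N \<theta>\<close>, as \<open>integral_cs_measure\<close>
  shows, written as a quotient so that numerator and normalisation can be estimated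
  separately.\<close>

definition mean :: "real \<Rightarrow> real" where
  "mean \<theta> = (\<integral>x. x / (1 - \<theta> * x) \<partial>N) / cs_norm N \<theta>"

lemma open_params: "open params"
  unfolding params_def by (intro open_Collect_conj open_Collect_less continuous_intros)

lemma convex_params: "convex params"
proof -
  have "params = {\<theta>. A * \<theta> < 1} \<inter> {\<theta>. B * \<theta> < 1}" by (auto simp: params_def mult.commute)
  then show ?thesis
    using convex_halfspace_lt[of A 1] convex_halfspace_lt[of B 1] by (auto intro: convex_Int)
qed

lemma zero_in_params: "0 \<in> params"
  by (simp add: params_def)

text \<open>An affine function of \<open>x\<close> attains its minimum over the interval at an
  endpoint. The bound is uniform in \<open>x\<close>, which makes the kernels bounded.\<close>

lemma kernel_denominator_lower:
  assumes "A \<le> x" "x \<le> B"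
  shows "min (1 - \<theta> * A) (1 - \<theta> * B) \<le> 1 - \<theta> * x"
proof (cases "\<theta> \<ge> 0")
  case True
  then show ?thesis using assms by (auto simp: min_le_iff_disj mult_left_mono)
next
  case False
  then show ?thesis using assms by (auto simp: min_le_iff_disj mult_left_mono_neg)
qed

lemma kernel_denominator_pos:
  assumes "\<theta> \<in> params" "A \<le> x" "x \<le> B"
  shows "0 < 1 - \<theta> * x"
  using kernel_denominator_lower[OF assms(2,3), of \<theta>] assms(1) by (auto simp: params_def)

lemma integrable_kernel:
  assumes \<theta>: "\<theta> \<in> params" and [measurable]: "h \<in> borel_measurable borel"
    and h: "\<And>x. A \<le> x \<Longrightarrow> x \<le> B \<Longrightarrow> \<bar>h x\<bar> \<le> K"
  shows "integrable N (\<lambda>x. h x / (1 - \<theta> * x))"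
proof (rule integrable_const_bound)
  let ?d = "min (1 - \<theta> * A) (1 - \<theta> * B)"
  show "AE x in N. norm (h x / (1 - \<theta> * x)) \<le> K / ?d"
    using AE_bounds
  proof eventually_elim
    case (elim x)
    have "0 < ?d" using \<theta> by (auto simp: params_def)
    moreover have "?d \<le> 1 - \<theta> * x" using kernel_denominator_lower elim by blast
    ultimately have "\<bar>h x\<bar> / (1 - \<theta> * x) \<le> K / ?d"
      using h[of x] elim by (intro frac_le) auto
    moreover have "0 < 1 - \<theta> * x" using \<open>0 < ?d\<close> \<open>?d \<le> 1 - \<theta> * x\<close> by linarith
    ultimately show ?case by simp
  qed
qed measurable

lemma abs_le_bounds: "A \<le> x \<Longrightarrow> x \<le> B \<Longrightarrow> \<bar>x\<bar> \<le> B - A"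
  using A_nonpos B_nonneg by auto

lemma integrable_kernel_one: "\<theta> \<in> params \<Longrightarrow> integrable N (\<lambda>x. 1 / (1 - \<theta> * x))"
  by (rule integrable_kernel[where K = 1]) auto

lemma integrable_kernel_id: "\<theta> \<in> params \<Longrightarrow> integrable N (\<lambda>x. x / (1 - \<theta> * x))"
  by (rule integrable_kernel[where K = "B - A"]) (auto intro: abs_le_bounds)

text \<open>A nonnegative integrand with zero integral vanishes almost everywhere, which a strictly
  positive one cannot do on a probability space.\<close>

lemma integral_pos_of_AE_pos:
  fixes f :: "real \<Rightarrow> real"
  assumes "integrable N f" "AE x in N. 0 < f x"
  shows "0 < (\<integral>x. f x \<partial>N)"
proof -
  have "(\<integral>x. f x \<partial>N) \<noteq> 0"
  proof
    assume "(\<integral>x. f x \<partial>N) = 0"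
    moreover have "AE x in N. 0 \<le> f x" using assms(2) by eventually_elim simp
    ultimately have "AE x in N. f x = 0"
      using integral_nonneg_eq_0_iff_AE[OF assms(1)] by blast
    with assms(2) have "AE x in N. False" by eventually_elim simp
    then show False by simp
  qed
  moreover have "0 \<le> (\<integral>x. f x \<partial>N)"
    using assms(2) by (intro integral_nonneg_AE) auto
  ultimately show ?thesis by simp
qed

lemma cs_norm_pos: "\<theta> \<in> params \<Longrightarrow> 0 < cs_norm N \<theta>"
  unfolding cs_norm_def
  by (intro integral_pos_of_AE_pos integrable_kernel_one eventually_mono[OF AE_bounds])
     (auto dest: kernel_denominator_pos)

section \<open>Continuity in the parameter\<close>

lemma continuous_on_kernel_integral:
  assumes h [measurable]: "h \<in> borel_measurable borel"
    and K: "\<And>x. A \<le> x \<Longrightarrow> x \<le> B \<Longrightarrow> \<bar>h x\<bar> \<le> K"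
  shows "continuous_on params (\<lambda>\<theta>. \<integral>x. h x / (1 - \<theta> * x) \<partial>N)"
proof -
  have "isCont (\<lambda>\<theta>. \<integral>x. h x / (1 - \<theta> * x) \<partial>N) \<theta>" if \<theta>: "\<theta> \<in> params" for \<theta>
  proof -
    obtain e where e: "0 < e" "cball \<theta> e \<subseteq> params"
      using open_params \<theta> open_contains_cball by blast
    define s t where "s = \<theta> - e" and "t = \<theta> + e"
    have st: "s \<in> params" "t \<in> params"
      using e by (auto simp: s_def t_def subset_iff dist_real_def)
    \<comment> \<open>For fixed \<open>x\<close> the kernel is monotone in the parameter, in a
      direction given by the sign of \<open>x\<close>. Hence on \<open>{s..t}\<close> it is largest
      at \<open>s\<close> or at \<open>t\<close>, and the sum of both values dominates it in either
      case.\<close>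
    let ?g = "\<lambda>x. \<bar>h x\<bar> / (1 - s * x) + \<bar>h x\<bar> / (1 - t * x)"
    have g: "integrable N ?g"
      using st K by (intro Bochner_Integration.integrable_add integrable_kernel[where K = K]) auto
    have bound: "\<bar>h x / (1 - \<eta> * x)\<bar> \<le> ?g x"
      if x: "A \<le> x" "x \<le> B" and \<eta>: "s \<le> \<eta>" "\<eta> \<le> t" for x \<eta>
    proof -
      have pos: "0 < 1 - s * x" "0 < 1 - t * x"
        using kernel_denominator_pos st x by blast+
      show ?thesis
      proof (cases "0 \<le> x")
        case True
        then have "1 - t * x \<le> 1 - \<eta> * x" using \<eta> by (simp add: mult_right_mono)
        with pos have "\<bar>h x\<bar> / (1 - \<eta> * x) \<le> \<bar>h x\<bar> / (1 - t * x)" "0 < 1 - \<eta> * x"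
          by (auto intro: divide_left_mono)
        with pos show ?thesis by (simp add: add_increasing)
      next
        case False
        then have "1 - s * x \<le> 1 - \<eta> * x" using \<eta> by (simp add: mult_right_mono_neg)
        with pos have "\<bar>h x\<bar> / (1 - \<eta> * x) \<le> \<bar>h x\<bar> / (1 - s * x)" "0 < 1 - \<eta> * x"
          by (auto intro: divide_left_mono)
        with pos show ?thesis by (simp add: add_increasing2)
      qed
    qed
    \<comment> \<open>Dominated convergence speaks of sequences, hence the sequential form of
      continuity; \<open>\<theta>\<close> lies in the interior of \<open>{s..t}\<close>.\<close>
    have "continuous_on {s..t} (\<lambda>\<theta>. \<integral>x. h x / (1 - \<theta> * x) \<partial>N)"
      unfolding continuous_on_sequentially comp_def
    proof (intro allI ballI impI, elim conjE)
      fix X \<eta> assume \<eta>: "\<eta> \<in> {s..t}" and X: "\<forall>n. X n \<in> {s..t}" "X \<longlonglongrightarrow> \<eta>"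
      show "(\<lambda>n. \<integral>x. h x / (1 - X n * x) \<partial>N) \<longlonglongrightarrow> (\<integral>x. h x / (1 - \<eta> * x) \<partial>N)"
      proof (rule integral_dominated_convergence[where w = ?g])
        have "\<eta> \<in> params"
          using e \<eta> by (auto simp: s_def t_def subset_iff dist_real_def abs_if)
        show "AE x in N. (\<lambda>n. h x / (1 - X n * x)) \<longlonglongrightarrow> h x / (1 - \<eta> * x)"
          using AE_bounds
          by eventually_elim
            (use kernel_denominator_pos[OF \<open>\<eta> \<in> params\<close>] X(2) in \<open>force intro!: tendsto_intros\<close>)
        show "AE x in N. norm (h x / (1 - X n * x)) \<le> ?g x" for n
          using AE_bounds
        proof eventually_elim
          case (elim x)
          then show ?case using bound[of x "X n"] X(1) by simp
        qed
      qed (use g in measurable)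
    qed
    then show ?thesis
      by (rule continuous_on_interior) (use e in \<open>auto simp: s_def t_def\<close>)
  qed
  then show ?thesis by (simp add: continuous_at_imp_continuous_on)
qed

lemma continuous_on_mean: "continuous_on params mean"
  unfolding mean_def cs_norm_def
  using continuous_on_kernel_integral[of "\<lambda>x. x" "B - A"] continuous_on_kernel_integral[of "\<lambda>_. 1" 1]
  by (intro continuous_on_divide) (auto dest: abs_le_bounds cs_norm_pos[unfolded cs_norm_def])

section \<open>Bounds and strict monotonicity of the mean\<close>

text \<open>Since the normalisation is positive, the position of the mean relative to any
  \<open>c\<close> can be read off from the sign of one integral.\<close>

lemma cs_norm_mult_mean_diff:
  assumes "\<theta> \<in> params"
  shows "(\<integral>x. (x - c) / (1 - \<theta> * x) \<partial>N) = cs_norm N \<theta> * (mean \<theta> - c)"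
proof -
  have "(\<integral>x. (x - c) / (1 - \<theta> * x) \<partial>N) =
      (\<integral>x. x / (1 - \<theta> * x) - c * (1 / (1 - \<theta> * x)) \<partial>N)"
    by (simp add: diff_divide_distrib)
  also have "\<dots> = (\<integral>x. x / (1 - \<theta> * x) \<partial>N) - c * cs_norm N \<theta>"
    using integrable_kernel_id[OF assms] integrable_mult_right[OF integrable_kernel_one[OF assms], of c]
    by (simp only: Bochner_Integration.integral_diff integral_mult_right_zero cs_norm_def)
  also have "\<dots> = cs_norm N \<theta> * (mean \<theta> - c)"
    using cs_norm_pos[OF assms] by (simp add: mean_def field_simps)
  finally show ?thesis .
qed

text \<open>With \<open>c = A\<close> and \<open>c = B\<close> the centred integrand has constant
  sign on the interval.\<close>

lemma mean_bounds:
  assumes "\<theta> \<in> params"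
  shows "A \<le> mean \<theta>" "mean \<theta> \<le> B"
proof -
  have "0 \<le> (\<integral>x. (x - A) / (1 - \<theta> * x) \<partial>N)"
    using AE_bounds
    by (intro integral_nonneg_AE, eventually_elim)
       (auto dest: kernel_denominator_pos[OF assms] intro!: divide_nonneg_pos)
  then show "A \<le> mean \<theta>"
    using cs_norm_pos[OF assms] by (simp add: cs_norm_mult_mean_diff[OF assms] zero_le_mult_iff)
  have "0 \<le> (\<integral>x. - ((x - B) / (1 - \<theta> * x)) \<partial>N)"
    using AE_bounds
    by (intro integral_nonneg_AE, eventually_elim)
       (auto dest: kernel_denominator_pos[OF assms] intro!: divide_nonpos_pos)
  then show "mean \<theta> \<le> B"
    using cs_norm_pos[OF assms] by (simp add: cs_norm_mult_mean_diff[OF assms] mult_le_0_iff)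
qed

lemma mean_strict_mono:
  assumes \<theta>: "\<theta> \<in> params" and \<eta>: "\<eta> \<in> params" and "\<theta> < \<eta>" and nd: "nondegenerate N"
  shows "mean \<theta> < mean \<eta>"
proof -
  define c where "c = mean \<theta>"
  \<comment> \<open>The mean \<open>c\<close> itself lies between \<open>A\<close> and
    \<open>B\<close>, so the denominators are positive there too.\<close>
  have c: "0 < 1 - \<eta> * c" "0 < 1 - \<theta> * c"
    using mean_bounds[OF \<theta>] kernel_denominator_pos \<eta> \<theta> by (auto simp: c_def)
  define q where "q x = (x - c)\<^sup>2 / ((1 - \<theta> * x) * (1 - \<eta> * x))" for x
  \<comment> \<open>The ratio \<open>r(x) = (1 - \<theta> x) / (1 - \<eta> x)\<close> of the two kernels is increasing; this is the identity
    \<open>(x - c) (r(x) - r(c)) = (\<eta> - \<theta>) (x - c)\<^sup>2 / ((1 - \<eta> x) (1 - \<eta> c))\<close>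
    multiplied by \<open>(1 - \<eta> c) / (1 - \<theta> x)\<close>.\<close>
  have q_eq: "(\<eta> - \<theta>) * q x =
      (1 - \<eta> * c) * ((x - c) / (1 - \<eta> * x)) - (1 - \<theta> * c) * ((x - c) / (1 - \<theta> * x))"
    if "A \<le> x" "x \<le> B" for x
  proof -
    have nz: "1 - \<eta> * x \<noteq> 0" "1 - \<theta> * x \<noteq> 0"
      using kernel_denominator_pos[OF \<eta> that] kernel_denominator_pos[OF \<theta> that] by auto
    have "(1 - \<eta> * c) * ((x - c) / (1 - \<eta> * x)) - (1 - \<theta> * c) * ((x - c) / (1 - \<theta> * x)) =
        ((1 - \<eta> * c) * (x - c) * (1 - \<theta> * x) - (1 - \<theta> * c) * (x - c) * (1 - \<eta> * x)) /
        ((1 - \<theta> * x) * (1 - \<eta> * x))"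
      unfolding times_divide_eq_right diff_frac_eq[OF nz] by (simp only: mult.commute)
    also have "(1 - \<eta> * c) * (x - c) * (1 - \<theta> * x) - (1 - \<theta> * c) * (x - c) * (1 - \<eta> * x) =
        (\<eta> - \<theta>) * (x - c)\<^sup>2"
      by (simp add: algebra_simps power2_eq_square)
    finally show ?thesis by (simp add: q_def)
  qed
  have int: "integrable N (\<lambda>x. (x - c) / (1 - \<zeta> * x))" if "\<zeta> \<in> params" for \<zeta>
    using integrable_kernel_id[OF that] integrable_kernel_one[OF that, THEN integrable_mult_right[of c]]
    by (simp add: diff_divide_distrib)
  \<comment> \<open>\<open>Q\<close> equals \<open>(\<eta> - \<theta>) * q\<close> on the interval.
    In this form its integral splits by linearity, while its sign and its zeros are read off from
    \<open>q\<close>.\<close>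
  define Q where "Q x = (1 - \<eta> * c) * ((x - c) / (1 - \<eta> * x)) -
      (1 - \<theta> * c) * ((x - c) / (1 - \<theta> * x))" for x
  have Q_int: "integrable N Q"
    unfolding Q_def
    by (intro Bochner_Integration.integrable_diff integrable_mult_right int \<theta> \<eta>)
  have Q_nonneg: "AE x in N. 0 \<le> Q x"
    using AE_bounds
  proof eventually_elim
    case (elim x)
    then have "0 \<le> q x"
      using kernel_denominator_pos[OF \<eta>] kernel_denominator_pos[OF \<theta>]
      by (simp add: q_def less_imp_le)
    with \<open>\<theta> < \<eta>\<close> have "0 \<le> (\<eta> - \<theta>) * q x" by simp
    then show ?case using q_eq[of x] elim by (simp only: Q_def)
  qed
  have "(\<integral>x. Q x \<partial>N) \<noteq> 0"
  proof
    assume "(\<integral>x. Q x \<partial>N) = 0"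
    then have "AE x in N. Q x = 0"
      using integral_nonneg_eq_0_iff_AE[OF Q_int Q_nonneg] by simp
    then have "AE x in N. x = c"
      using AE_bounds
    proof eventually_elim
      case (elim x)
      then have "q x = 0" using q_eq[of x] \<open>\<theta> < \<eta>\<close> by (simp add: Q_def)
      then show ?case
        using kernel_denominator_pos[OF \<eta>] kernel_denominator_pos[OF \<theta>] elim
        by (force simp: q_def)
    qed
    then show False
      using eq_return_if_AE_eq_const[OF prob_space_axioms sets_N] nd by (auto simp: nondegenerate_def)
  qed
  moreover have "0 \<le> (\<integral>x. Q x \<partial>N)" using Q_nonneg by (rule integral_nonneg_AE)
  \<comment> \<open>The part with parameter \<open>\<theta>\<close> integrates to a multiple of
    \<open>mean \<theta> - c\<close>, which is 0 by the choice of \<open>c\<close>.\<close>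
  moreover have "(\<integral>x. Q x \<partial>N) = (1 - \<eta> * c) * (cs_norm N \<eta> * (mean \<eta> - c))"
    unfolding Q_def
    by (subst Bochner_Integration.integral_diff; (intro integrable_mult_right int \<theta> \<eta>)?)
       (simp only: integral_mult_right_zero cs_norm_mult_mean_diff \<theta> \<eta>, simp add: c_def)
  ultimately have "0 < (1 - \<eta> * c) * (cs_norm N \<eta> * (mean \<eta> - c))" by linarith
  then show ?thesis
    using c cs_norm_pos[OF \<eta>] by (simp add: zero_less_mult_iff c_def)
qed

section \<open>Means of the family and the Cauchy transform\<close>

lemma integral_cs_measure:
  assumes "\<theta> \<in> params"
  shows "(\<integral>x. x \<partial>cs_measure N \<theta>) = mean \<theta>"
proof -
  have "(\<integral>x. x \<partial>cs_measure N \<theta>) = (\<integral>x. 1 / (cs_norm N \<theta> * (1 - \<theta> * x)) * x \<partial>N)"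
    unfolding cs_measure_def
  proof (subst integral_density)
    show "AE x in N. 0 \<le> 1 / (cs_norm N \<theta> * (1 - \<theta> * x))"
      using AE_bounds by eventually_elim
        (use kernel_denominator_pos[OF assms] cs_norm_pos[OF assms] in \<open>force intro: less_imp_le\<close>)
  qed auto
  also have "\<dots> = (\<integral>x. (x / (1 - \<theta> * x)) / cs_norm N \<theta> \<partial>N)"
    by (simp add: mult.commute)
  finally show ?thesis by (simp only: mean_def Bochner_Integration.integral_divide_zero)
qed

text \<open>Centring at \<open>c = z\<close> makes the kernel constant:
  \<open>(x - z) / (1 - x / z) = - z\<close>. Combined with
  \<open>cs_norm N (1 / z) = z * cauchy_transform N z\<close>, this gives a product equal to 1, so
  the transform is nonzero and can be inverted.\<close>

lemma mean_inverse:
  assumes "z \<noteq> 0" "1 / z \<in> params"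
  shows "1 / cauchy_transform N z = z - mean (1 / z)"
proof -
  \<comment> \<open>At \<open>x = z\<close> both sides are 0 because division by zero yields 0, so
    the identity holds for every \<open>x\<close>.\<close>
  have eq: "1 / (1 - 1 / z * x) = z * (1 / (z - x))" for x
    using assms(1) by (simp add: field_simps)
  have M: "cs_norm N (1 / z) = z * cauchy_transform N z"
    unfolding cs_norm_def cauchy_transform_def by (simp only: eq integral_mult_right_zero)
  have "(\<integral>x. (x - z) / (1 - 1 / z * x) \<partial>N) = (\<integral>x. - z \<partial>N)"
  proof (rule integral_cong_AE)
    show "AE x in N. (x - z) / (1 - 1 / z * x) = - z"
      using AE_bounds
    proof eventually_elim
      case (elim x)
      have "1 - 1 / z * x \<noteq> 0" using kernel_denominator_pos[OF assms(2)] elim by force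
      moreover have "x - z = - z * (1 - 1 / z * x)"
        using assms(1) by (simp add: field_simps)
      ultimately show ?case by (metis nonzero_eq_divide_eq)
    qed
  qed auto
  then have "z * cauchy_transform N z * (mean (1 / z) - z) = - z"
    by (simp only: cs_norm_mult_mean_diff[OF assms(2)] M lebesgue_integral_const prob_space) simp
  then have "z * (cauchy_transform N z * (z - mean (1 / z))) = z * 1"
    by (simp add: algebra_simps)
  then have "cauchy_transform N z * (z - mean (1 / z)) = 1"
    using assms(1) by simp
  then show ?thesis by (auto simp: divide_eq_eq mult.commute)
qed

section \<open>One-sided limits at the endpoints\<close>

lemma bdd_mean: "bdd_above (mean ` params)" "bdd_below (mean ` params)"
  using mean_bounds by (auto intro!: bdd_aboveI2[where M = B] bdd_belowI2[where m = A])

lemma mean_image_nonempty: "mean ` params \<noteq> {}"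
  using zero_in_params by blast

lemma inverse_in_params_right: "B < z \<Longrightarrow> 1 / z \<in> params"
  using A_nonpos B_nonneg by (auto simp: params_def field_simps)

lemma inverse_in_params_left: "z < A \<Longrightarrow> 1 / z \<in> params"
  using A_nonpos B_nonneg by (auto simp: params_def field_simps)

lemma mean_mono:
  assumes "nondegenerate N" "\<theta> \<in> params" "\<eta> \<in> params" "\<theta> \<le> \<eta>"
  shows "mean \<theta> \<le> mean \<eta>"
  using mean_strict_mono[of \<theta> \<eta>] assms by (cases "\<theta> = \<eta>") auto

text \<open>As \<open>z\<close> decreases to \<open>B\<close>, \<open>1 / z\<close> increases to the
  upper end of \<open>params\<close>, finite or not. Every \<open>z > B\<close> works for
  \<open>\<theta> \<le> 0\<close>; otherwise \<open>z\<close> is taken between \<open>B\<close> and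
  \<open>1 / \<theta>\<close>.\<close>

lemma eventually_less_inverse_at_right:
  assumes "\<theta> \<in> params"
  shows "eventually (\<lambda>z. \<theta> < 1 / z) (at_right B)"
proof (cases "\<theta> \<le> 0")
  case True
  have "\<theta> < 1 / z" if "B < z" for z
    using True that B_nonneg by (intro le_less_trans[OF True]) auto
  then show ?thesis
    by (auto simp: eventually_at_filter)
next
  case False
  with assms have "B < 1 / \<theta>" by (simp add: params_def field_simps)
  then show ?thesis
    unfolding eventually_at_right[OF \<open>B < 1 / \<theta>\<close>]
    by (intro exI[of _ "1 / \<theta>"]) (use False B_nonneg in \<open>auto simp: field_simps\<close>)
qed

lemma eventually_inverse_less_at_left:
  assumes "\<theta> \<in> params"
  shows "eventually (\<lambda>z. 1 / z < \<theta>) (at_left A)"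
proof (cases "0 \<le> \<theta>")
  case True
  have "1 / z < \<theta>" if "z < A" for z
    using that A_nonpos by (intro less_le_trans[OF _ True]) auto
  then show ?thesis
    by (auto simp: eventually_at_filter)
next
  case False
  with assms have "1 / \<theta> < A" by (simp add: params_def field_simps)
  then show ?thesis
    unfolding eventually_at_left[OF \<open>1 / \<theta> < A\<close>]
    by (intro exI[of _ "1 / \<theta>"]) (use False A_nonpos in \<open>auto simp: field_simps\<close>)
qed

text \<open>The supremum bounds all values from above. Conversely, a parameter whose mean exceeds
  \<open>y\<close> is eventually passed by \<open>1 / z\<close>, and monotonicity keeps the mean
  above \<open>y\<close>.\<close>

lemma mean_inverse_tendsto_Sup:
  assumes "nondegenerate N"
  shows "((\<lambda>z. mean (1 / z)) \<longlongrightarrow> Sup (mean ` params)) (at_right B)"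
proof (rule order_tendstoI)
  have in_params: "eventually (\<lambda>z. 1 / z \<in> params) (at_right B)"
    using inverse_in_params_right by (auto simp: eventually_at_filter)
  show "eventually (\<lambda>z. mean (1 / z) < y) (at_right B)" if "Sup (mean ` params) < y" for y
    using in_params
    by eventually_elim (rule le_less_trans[OF cSup_upper[OF imageI bdd_mean(1)] that])
  show "eventually (\<lambda>z. y < mean (1 / z)) (at_right B)" if "y < Sup (mean ` params)" for y
  proof -
    obtain \<theta> where \<theta>: "\<theta> \<in> params" "y < mean \<theta>"
      using \<open>y < Sup (mean ` params)\<close> less_cSup_iff[OF mean_image_nonempty bdd_mean(1), of y] by blast
    show ?thesis
      using in_params eventually_less_inverse_at_right[OF \<theta>(1)]
      by eventually_elim (use \<theta> mean_mono[OF assms \<theta>(1)] in fastforce)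
  qed
qed

lemma mean_inverse_tendsto_Inf:
  assumes "nondegenerate N"
  shows "((\<lambda>z. mean (1 / z)) \<longlongrightarrow> Inf (mean ` params)) (at_left A)"
proof (rule order_tendstoI)
  have in_params: "eventually (\<lambda>z. 1 / z \<in> params) (at_left A)"
    using inverse_in_params_left by (auto simp: eventually_at_filter)
  show "eventually (\<lambda>z. y < mean (1 / z)) (at_left A)" if "y < Inf (mean ` params)" for y
    using in_params
    by eventually_elim (rule less_le_trans[OF that cInf_lower[OF imageI bdd_mean(2)]])
  show "eventually (\<lambda>z. mean (1 / z) < y) (at_left A)" if "Inf (mean ` params) < y" for y
  proof -
    obtain \<theta> where \<theta>: "\<theta> \<in> params" "mean \<theta> < y"
      using \<open>Inf (mean ` params) < y\<close> cInf_less_iff[OF mean_image_nonempty bdd_mean(2), of y] by blast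
    show ?thesis
      using in_params eventually_inverse_less_at_left[OF \<theta>(1)]
      by eventually_elim (use \<theta> mean_mono[OF assms _ \<theta>(1)] in fastforce)
  qed
qed

text \<open>The limit comes from that of \<open>z - mean (1 / z)\<close>, so it exists even where
  the transform itself diverges at \<open>B\<close>.\<close>

lemma inverse_cauchy_tendsto_right:
  assumes "nondegenerate N"
  shows "((\<lambda>z. 1 / cauchy_transform N z) \<longlongrightarrow> B - Sup (mean ` params)) (at_right B)"
proof (rule Lim_transform_eventually)
  show "((\<lambda>z. z - mean (1 / z)) \<longlongrightarrow> B - Sup (mean ` params)) (at_right B)"
    by (intro tendsto_diff mean_inverse_tendsto_Sup assms tendsto_ident_at)
  have "z - mean (1 / z) = 1 / cauchy_transform N z" if "B < z" for z
    using mean_inverse[of z] inverse_in_params_right[OF that] that B_nonneg by auto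
  then show "eventually (\<lambda>z. z - mean (1 / z) = 1 / cauchy_transform N z) (at_right B)"
    by (auto simp: eventually_at_filter)
qed

lemma inverse_cauchy_tendsto_left:
  assumes "nondegenerate N"
  shows "((\<lambda>z. 1 / cauchy_transform N z) \<longlongrightarrow> A - Inf (mean ` params)) (at_left A)"
proof (rule Lim_transform_eventually)
  show "((\<lambda>z. z - mean (1 / z)) \<longlongrightarrow> A - Inf (mean ` params)) (at_left A)"
    by (intro tendsto_diff mean_inverse_tendsto_Inf assms tendsto_ident_at)
  have "z - mean (1 / z) = 1 / cauchy_transform N z" if "z < A" for z
    using mean_inverse[of z] inverse_in_params_left[OF that] that A_nonpos by auto
  then show "eventually (\<lambda>z. z - mean (1 / z) = 1 / cauchy_transform N z) (at_left A)"
    by (auto simp: eventually_at_filter)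
qed

section \<open>Range of the mean\<close>

text \<open>Since \<open>params\<close> is open, each parameter can be moved a little both ways, and
  strict monotonicity then excludes the extreme values. Connectedness of the image fills everything
  between them.\<close>

lemma mean_image_params:
  assumes nd: "nondegenerate N"
  shows "mean ` params = {Inf (mean ` params) <..< Sup (mean ` params)}"
proof (intro equalityI subsetI)
  fix y assume "y \<in> mean ` params"
  then obtain \<theta> where \<theta>: "\<theta> \<in> params" "y = mean \<theta>" by blast
  obtain e where e: "0 < e" "cball \<theta> e \<subseteq> params"
    using open_params \<theta>(1) open_contains_cball by blast
  then have st: "\<theta> - e \<in> params" "\<theta> + e \<in> params"
    by (auto simp: subset_iff dist_real_def)
  have "mean (\<theta> - e) < y" "y < mean (\<theta> + e)"
    using \<theta> e st by (auto intro: mean_strict_mono nd)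
  moreover have "Inf (mean ` params) \<le> mean (\<theta> - e)" "mean (\<theta> + e) \<le> Sup (mean ` params)"
    using st by (auto intro: cInf_lower cSup_upper bdd_mean)
  ultimately show "y \<in> {Inf (mean ` params) <..< Sup (mean ` params)}" by simp
next
  fix y assume y: "y \<in> {Inf (mean ` params) <..< Sup (mean ` params)}"
  obtain u where u: "u \<in> mean ` params" "u < y"
    using y cInf_less_iff[OF mean_image_nonempty bdd_mean(2), of y] by auto
  obtain v where v: "v \<in> mean ` params" "y < v"
    using y less_cSup_iff[OF mean_image_nonempty bdd_mean(1), of y] by auto
  have "connected (mean ` params)"
    by (intro connected_continuous_image continuous_on_mean convex_connected convex_params)
  then show "y \<in> mean ` params"
    using connectedD_interval[OF _ u(1) v(1), of y] u(2) v(2) by simp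
qed

end

section \<open>Domain of means in terms of the support\<close>

theorem mainTheorem2:
  fixes \<nu> :: "real measure"
  assumes "prob_space \<nu>"
    and "sets \<nu> = sets borel"
    and "compact (measure_support \<nu>)"
    and "nondegenerate \<nu>"
  shows "((\<lambda>z. 1 / cauchy_transform \<nu> z) \<longlongrightarrow> inv_cauchy_A \<nu>) (at_left (endpoint_A \<nu>))
    \<and> ((\<lambda>z. 1 / cauchy_transform \<nu> z) \<longlongrightarrow> inv_cauchy_B \<nu>) (at_right (endpoint_B \<nu>))
    \<and> domain_of_means \<nu> = {m_minus \<nu> <..< m_plus \<nu>}"
proof -
  let ?A = "endpoint_A \<nu>" and ?B = "endpoint_B \<nu>"
  have signs: "?A \<le> 0" "0 \<le> ?B" by (auto simp: endpoint_A_def endpoint_B_def)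
  interpret prob_space \<nu> by fact
  interpret interval_prob_space \<nu> ?A ?B
    by unfold_locales (use assms AE_compact_support_bounds signs in auto)
  note limA = inverse_cauchy_tendsto_left[OF assms(4)]
    and limB = inverse_cauchy_tendsto_right[OF assms(4)]
  \<comment> \<open>\<open>Lim\<close> picks the limit by description; uniqueness of limits along a
    nontrivial filter identifies it with the one already found.\<close>
  have invA: "inv_cauchy_A \<nu> = ?A - Inf (mean ` params)"
    unfolding inv_cauchy_A_def using limA by (rule tendsto_Lim[rotated]) simp
  have invB: "inv_cauchy_B \<nu> = ?B - Sup (mean ` params)"
    unfolding inv_cauchy_B_def using limB by (rule tendsto_Lim[rotated]) simp
  \<comment> \<open>If an endpoint is 0, the product condition always holds, matching the infinite
    bound; otherwise multiply by the endpoint, which reverses the inequality for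
    \<open>?A\<close>.\<close>
  have params_iff: "theta_minus \<nu> < ereal \<theta> \<and> ereal \<theta> < theta_plus \<nu> \<longleftrightarrow> \<theta> \<in> params" for \<theta>
  proof -
    have "theta_minus \<nu> < ereal \<theta> \<longleftrightarrow> \<theta> * ?A < 1"
      using signs by (auto simp: theta_minus_def field_simps)
    moreover have "ereal \<theta> < theta_plus \<nu> \<longleftrightarrow> \<theta> * ?B < 1"
      using signs by (auto simp: theta_plus_def field_simps)
    ultimately show ?thesis by (simp add: params_def)
  qed
  have "domain_of_means \<nu> = mean ` params"
    unfolding domain_of_means_def cs_family_def params_iff
    using integral_cs_measure by (auto simp: image_iff) metis
  also have "\<dots> = {m_minus \<nu> <..< m_plus \<nu>}"
    using mean_image_params[OF assms(4)] by (simp add: m_minus_def m_plus_def invA invB)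
  finally show ?thesis using limA limB by (simp add: invA invB)
qed

end
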